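(* For $k>0$ we have the identity $$\zeta_{\mathcal P}(\{4\}^k)=\sum_{\ell(\lambda)=k}\frac1{n_\lambda^4}=\frac{1}{16^{k-1}}\left(\sum_{n=0}^{2k}(-1)^n\left(2^{2n-1}-1\right)\left(2^{4k-2n-1}-1\right)\zeta(2n)\,\zeta(4k-2n)\right),$$ and increasingly complicated formulas can be computed for $\zeta_{\mathcal P}(\{2^t\}^k)$, $t\in\mathbb Z^+$.
   Context: A partition is a finite non-increasing sequence $\lambda=(\lambda_1,\dots,\lambda_r)$ of positive integers (including the empty partition $\emptyset$, $r=0$); its length is $\ell(\lambda):=r$ and its integer is $n_\lambda:=\lambda_1\lambda_2\cdots\lambda_r$ (with $n_\emptyset:=1$). For $s\in\mathbb C$ with $\operatorname{Re}(s)>1$ and an integer $k\ge0$, $\zeta_{\mathcal P}(\{s\}^k):=\sum_{\ell(\lambda)=k}n_\lambda^{-s}$, the sum being over all partitions of length exactly $k$. Here $k$ is an integer, $\mathbb Z^+$ is the set of positive integers, and $\zeta$ is the Riemann zeta function, with $\zeta(0)=-1/2$ by analytic continuation. *)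

theory Defs
  imports "HOL-Complex_Analysis.Complex_Analysis"
begin

definition partitions_of_length :: "nat \<Rightarrow> nat list set" where
  "partitions_of_length k = {l. sorted_wrt (\<ge>) l \<and> (\<forall>x\<in>set l. x > 0) \<and> length l = k}"

text \<open>
  The integer of a partition \<open>l\<close> is \<open>prod_list l\<close>, which is \<open>1\<close> for the empty partition.
\<close>

definition partition_zeta :: "complex \<Rightarrow> nat \<Rightarrow> complex" where
  "partition_zeta s k = (\<Sum>\<^sub>\<infinity>l\<in>partitions_of_length k. of_nat (prod_list l) powr (- s))"

text \<open>
  The value of the Riemann zeta function at \<open>s \<noteq> 1\<close>: the Dirichlet series is continued
  analytically to a punctured half-plane containing \<open>s\<close>. The punctured half-planes to the
  left of the line \<open>Re z = 1\<close> are nested and connected, so the value depends neither on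
  \<open>c\<close> nor on \<open>f\<close>. At the pole \<open>s = 1\<close> the description is not unique and the value is
  unspecified.
\<close>

definition riemann_zeta :: "complex \<Rightarrow> complex" where
  "riemann_zeta s = (THE v. \<exists>c f. c < Re s \<and> c \<le> 1 \<and>
     f holomorphic_on ({z. Re z > c} - {1}) \<and>
     (\<forall>z. Re z > 1 \<longrightarrow> (\<lambda>n. of_nat (Suc n) powr (- z)) sums f z) \<and>
     v = f s)"

text \<open>
  The formula for exponent \<open>2 ^ Suc m\<close> as a finite expression in values of the zeta function
  at even arguments. The base case (exponent \<open>2\<close>) consists of the coefficients of
  \<open>\<pi>x / sin (\<pi>x) = (\<Prod>n\<ge>1. 1 / (1 - x\<^sup>2 / n\<^sup>2))\<close>. With
  \<open>P s x = (\<Prod>n\<ge>1. 1 / (1 - x / n ^ s))\<close>, whose \<open>k\<close>-th coefficient is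
  \<open>partition_zeta s k\<close>, the step compares coefficients in
  \<open>P (2 * s) (x\<^sup>2) = P s x * P s (- x)\<close>.
\<close>

primrec dyadic_formula :: "nat \<Rightarrow> nat \<Rightarrow> complex" where
  "dyadic_formula 0 k =
     (2 powi (2 * int k - 1) - 1) / 2 powi (2 * int k - 2) * riemann_zeta (of_nat (2 * k))"
| "dyadic_formula (Suc m) k =
     (\<Sum>n=0..2*k. (-1) ^ n * dyadic_formula m n * dyadic_formula m (2 * k - n))"

end

theory Submission
  imports Defs
begin

text \<open>
  Restrict to partitions with parts at most \<open>N\<close>: the sum over those of length \<open>k\<close> is the complete
  homogeneous symmetric polynomial \<open>h\<^sub>k\<close> in \<open>1 / 1 ^ s, \<dots>, 1 / N ^ s\<close>. For \<open>s = 2\<close>, partial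
  fractions turn it into \<open>2 * (\<Sum>n=1..N. (-1) ^ (n - 1) * c N n / n ^ (2 * k))\<close> with
  \<open>\<bar>c N n\<bar> \<le> 1\<close> and \<open>c N n\<close> tending to \<open>1\<close>, so by dominated convergence the limit is twice the
  alternating zeta value, \<open>2 * (1 - 2 / 2 ^ (2 * k)) * \<zeta> (2 * k)\<close>. Passing from \<open>s\<close> to \<open>2 * s\<close>
  squares the variables, and the generating functions satisfy
  \<open>(\<Prod>j. 1 / (1 - x\<^sub>j\<^sup>2 * t\<^sup>2)) = (\<Prod>j. 1 / (1 - x\<^sub>j * t)) * (\<Prod>j. 1 / (1 + x\<^sub>j * t))\<close>;
  comparing coefficients gives the recursive step, which survives the limit because it is a
  finite sum. The boundary terms need \<open>\<zeta> 0 = -1/2\<close>, read off from an Euler--Maclaurin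
  continuation of the Dirichlet series.
\<close>

section \<open>Values of the zeta function\<close>

text \<open>As a function of the interval length \<open>h\<close>, the trapezoid error on [a, a + h]
  vanishes to second order at 0, so Taylor's formula bounds it at \<open>h = 1\<close> by its second
  derivative \<open>g2\<close>.\<close>

lemma trapezoid_error_powr_bound:
  fixes s :: complex and a :: real
  assumes "s \<noteq> 1" "Re s > -2" "a > 0"
  shows "norm ((of_real a powr (-s) + (of_real a + 1) powr (-s)) / 2
           - ((of_real a + 1) powr (1 - s) - of_real a powr (1 - s)) / (1 - s))
         \<le> norm s * norm (s + 1) * a powr (- Re s - 2)"
proof -
  define g0 where "g0 = (\<lambda>h::complex. h * (of_real a powr (-s) + (of_real a + h) powr (-s)) / 2
       - ((of_real a + h) powr (1 - s) - of_real a powr (1 - s)) / (1 - s))"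
  define g1 where "g1 = (\<lambda>h::complex. (of_real a powr (-s) - (of_real a + h) powr (-s)) / 2
       - h * s * (of_real a + h) powr (-s - 1) / 2)"
  define g2 where "g2 = (\<lambda>h::complex. h * (s * (s + 1)) * (of_real a + h) powr (-s - 2) / 2)"
  define f where "f = (\<lambda>i::nat. if i = 0 then g0 else if i = 1 then g1 else g2)"
  define B where "B = norm s * norm (s + 1) * a powr (- Re s - 2)"
  have seg: "\<exists>u. h = of_real u \<and> 0 \<le> u \<and> u \<le> 1" if "h \<in> closed_segment 0 (1::complex)" for h
    using that by (auto simp: in_segment scaleR_conv_of_real)
  have nonpos: "of_real a + h \<notin> \<real>\<^sub>\<le>\<^sub>0" if "h \<in> closed_segment 0 (1::complex)" for h
    using seg[OF that] \<open>a > 0\<close> by (auto simp: complex_nonpos_Reals_iff)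
  have s1: "1 - s \<noteq> 0" using assms by auto
  have d0: "(g0 has_field_derivative g1 h) (at h)" if "h \<in> closed_segment 0 1" for h
    unfolding g0_def g1_def
    apply (rule derivative_eq_intros refl nonpos that s1 | simp)+
    using s1 by (simp add: field_simps)
  have d1: "(g1 has_field_derivative g2 h) (at h)" if "h \<in> closed_segment 0 1" for h
    unfolding g1_def g2_def
    apply (rule derivative_eq_intros refl nonpos that s1 | simp)+
    by (simp add: field_simps minus_diff_commute)
  have B: "norm (g2 h) \<le> B" if h: "h \<in> closed_segment 0 1" for h
  proof -
    obtain u where u: "h = of_real u" "0 \<le> u" "u \<le> 1" using seg[OF h] by blast
    have "norm ((of_real a + h) powr (-s - 2)) = norm (of_real (a + u) powr (-s - 2))"
      by (simp add: u)
    also have "\<dots> = (a + u) powr (- Re s - 2)"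
      using u \<open>a > 0\<close> by (subst norm_powr_real_powr) auto
    also have "\<dots> \<le> a powr (- Re s - 2)"
      using u assms by (intro powr_mono2') auto
    finally have *: "norm ((of_real a + h) powr (-s - 2)) \<le> a powr (- Re s - 2)" .
    have "norm (g2 h) = (norm h / 2) * (norm s * norm (s + 1) * norm ((of_real a + h) powr (-s - 2)))"
      by (simp add: g2_def norm_mult norm_divide)
    also have "\<dots> \<le> 1 * (norm s * norm (s + 1) * a powr (- Re s - 2))"
      using * u by (intro mult_mono) auto
    finally show ?thesis by (simp add: B_def)
  qed
  have "norm (f 0 1 - (\<Sum>i\<le>1. f i 0 * (1 - 0) ^ i / fact i)) \<le> B * norm (1 - 0 :: complex) ^ Suc 1 / fact 1"
  proof (rule complex_Taylor[where S = "closed_segment 0 1"])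
    fix i :: nat and h :: complex
    assume h: "h \<in> closed_segment 0 1" and "i \<le> 1"
    then show "(f i has_field_derivative f (Suc i) h) (at h within closed_segment 0 1)"
      using d0[OF h] d1[OF h]
      by (cases i) (auto simp: f_def intro: has_field_derivative_at_within)
  qed (use B in \<open>auto simp: f_def\<close>)
  then show ?thesis
    by (simp add: f_def g0_def g1_def B_def)
qed

text \<open>The subtracted quotient is the integral of \<open>x powr (-s)\<close> over
  [n + 1, n + 2].\<close>

definition trapezoid_error :: "complex \<Rightarrow> nat \<Rightarrow> complex" where
  "trapezoid_error s n = (of_nat (Suc n) powr (-s) + of_nat (Suc (Suc n)) powr (-s)) / 2
     - (of_nat (Suc (Suc n)) powr (1 - s) - of_nat (Suc n) powr (1 - s)) / (1 - s)"

text \<open>For \<open>Re s > -1/2\<close> the exponent \<open>- Re s - 2\<close> stays below the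
  summable -3/2, and the bound depends on \<open>s\<close> only through \<open>B\<close>, as the
  M-test requires.\<close>

lemma norm_trapezoid_error_le:
  assumes "s \<noteq> 1" "Re s > -1/2" "norm s \<le> B"
  shows "norm (trapezoid_error s n) \<le> B * (B + 1) * real (Suc n) powr (-3/2)"
proof -
  have B: "B \<ge> 0" using assms norm_ge_zero order_trans by blast
  have "norm (trapezoid_error s n) \<le> norm s * norm (s + 1) * real (Suc n) powr (- Re s - 2)"
    using trapezoid_error_powr_bound[of s "real (Suc n)"] assms
    by (simp add: trapezoid_error_def add_ac)
  also have "\<dots> \<le> B * (B + 1) * real (Suc n) powr (-3/2)"
  proof (intro mult_mono)
    show "norm (s + 1) \<le> B + 1"
      using norm_triangle_ineq[of s 1] assms by simp
    have "- Re s - 2 \<le> -3/2"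
      using assms(2) by (simp add: field_simps)
    then show "real (Suc n) powr (- Re s - 2) \<le> real (Suc n) powr (-3/2)"
      by (intro powr_mono) auto
  qed (use assms B in auto)
  finally show ?thesis .
qed

lemma summable_Suc_powr:
  assumes "a < -1"
  shows "summable (\<lambda>n. real (Suc n) powr a)"
  using assms by (subst summable_Suc_iff) (simp add: summable_real_powr_iff)

lemma summable_trapezoid_error:
  assumes "s \<noteq> 1" "Re s > -1/2"
  shows "summable (trapezoid_error s)"
proof (rule summable_comparison_test)
  show "\<exists>N. \<forall>n\<ge>N. norm (trapezoid_error s n)
      \<le> norm s * (norm s + 1) * real (Suc n) powr (-3/2)"
    using norm_trapezoid_error_le[OF assms order_refl] by blast
qed (intro summable_mult summable_Suc_powr, simp)

text \<open>
  Summing the trapezoid errors of \<open>x powr (-s)\<close> over the intervals between consecutive positive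
  integers gives the first step of Euler--Maclaurin summation, which converges to the left of \<open>Re s = 0\<close>.
\<close>

definition zeta_cont :: "complex \<Rightarrow> complex" where
  "zeta_cont s = 1 / (s - 1) + 1 / 2 + (\<Sum>n. trapezoid_error s n)"

lemma holomorphic_zeta_cont: "zeta_cont holomorphic_on ({z. Re z > -1/2} - {1})"
proof -
  let ?S = "{z. Re z > -1/2} - {1 :: complex}"
  have opn: "open ?S"
    by (intro open_Diff open_halfspace_Re_gt closed_singleton)
  have "(\<lambda>s. \<Sum>n. trapezoid_error s n) holomorphic_on ?S"
  proof (rule holomorphic_uniform_sequence[OF opn])
    show "(\<lambda>s. \<Sum>i<n. trapezoid_error s i) holomorphic_on ?S" for n
      unfolding trapezoid_error_def by (intro holomorphic_intros) auto
    fix x assume "x \<in> ?S"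
    then obtain d where d: "d > 0" "cball x d \<subseteq> ?S"
      using opn open_contains_cball_eq by blast
    have "uniform_limit (cball x d) (\<lambda>n s. \<Sum>i<n. trapezoid_error s i)
            (\<lambda>s. \<Sum>n. trapezoid_error s n) sequentially"
    proof (rule Weierstrass_m_test)
      fix n s assume s: "s \<in> cball x d"
      have "norm s \<le> norm x + d"
        using s norm_triangle_ineq2[of s x] by (simp add: dist_norm norm_minus_commute)
      then show "norm (trapezoid_error s n)
          \<le> (norm x + d) * ((norm x + d) + 1) * real (Suc n) powr (-3/2)"
        using s d by (intro norm_trapezoid_error_le) auto
    qed (intro summable_mult summable_Suc_powr, simp)
    with d show "\<exists>d>0. cball x d \<subseteq> ?S \<and> uniform_limit (cball x d)
        (\<lambda>n s. \<Sum>i<n. trapezoid_error s i) (\<lambda>s. \<Sum>n. trapezoid_error s n) sequentially"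
      by blast
  qed
  then show ?thesis
    unfolding zeta_cont_def by (intro holomorphic_intros) auto
qed

lemma sums_zeta_cont:
  assumes "Re s > 1"
  shows "(\<lambda>n. of_nat (Suc n) powr (-s)) sums zeta_cont s"
proof -
  have s1: "s \<noteq> 1" using assms by auto
  \<comment> \<open>The averages add up to the Dirichlet partial sum except for half of the end
    terms, and the integrals telescope.\<close>
  have eq: "(\<Sum>n<N. of_nat (Suc n) powr (-s)) = (\<Sum>n<N. trapezoid_error s n)
     + (1 - of_nat (Suc N) powr (-s)) / 2 + (of_nat (Suc N) powr (1 - s) - 1) / (1 - s)" for N
  proof (induction N)
    case (Suc N)
    then show ?case
      by (simp add: trapezoid_error_def diff_divide_distrib add_divide_distrib)
  qed auto
  have "(\<lambda>N. (\<Sum>n<N. trapezoid_error s n)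
     + (1 - of_nat (Suc N) powr (-s)) / 2 + (of_nat (Suc N) powr (1 - s) - 1) / (1 - s))
     \<longlonglongrightarrow> (\<Sum>n. trapezoid_error s n) + (1 - 0) / 2 + (0 - 1) / (1 - s)"
    using assms s1
    by (intro tendsto_intros summable_LIMSEQ summable_trapezoid_error
        tendsto_neg_powr_complex_of_nat filterlim_Suc) auto
  also have "(\<Sum>n. trapezoid_error s n) + (1 - 0) / 2 + (0 - 1) / (1 - s) = zeta_cont s"
    using s1 by (simp add: zeta_cont_def divide_simps) (simp add: algebra_simps)
  finally show ?thesis
    unfolding sums_def eq .
qed

section \<open>Uniqueness of the continuation, and special values\<close>

text \<open>The difference vanishes for \<open>Re z > 1\<close>, and the common domain is a
  punctured half-plane, still connected; the identity theorem applies.\<close>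

lemma zeta_continuation_unique:
  assumes "c \<le> 1" "c < Re s" "s \<noteq> 1"
    and f: "f holomorphic_on ({z. Re z > c} - {1})"
           "\<And>z. Re z > 1 \<Longrightarrow> (\<lambda>n. of_nat (Suc n) powr (-z)) sums f z"
    and c': "c' \<le> 1" "c' < Re s"
    and g: "g holomorphic_on ({z. Re z > c'} - {1})"
           "\<And>z. Re z > 1 \<Longrightarrow> (\<lambda>n. of_nat (Suc n) powr (-z)) sums g z"
  shows "f s = g s"
proof -
  let ?S = "{z. Re z > max c c'} - {1}"
  have "f s - g s = 0"
  proof (rule analytic_continuation[where f = "\<lambda>z. f z - g z" and S = ?S
        and U = "{z. Re z > 1}" and \<xi> = 2])
    show "(\<lambda>z. f z - g z) holomorphic_on ?S"
      using f(1) g(1) by (intro holomorphic_intros) (auto elim: holomorphic_on_subset)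
    show "open ?S"
      by (intro open_Diff open_halfspace_Re_gt closed_singleton)
    show "connected ?S"
      by (intro connected_open_delete open_halfspace_Re_gt convex_connected
          convex_halfspace_Re_gt) auto
    show "(2::complex) islimpt {z. 1 < Re z}"
      by (rule interior_limit_point) (auto simp: interior_open open_halfspace_Re_gt)
    show "f z - g z = 0" if "z \<in> {z. 1 < Re z}" for z
      using f(2) g(2) sums_unique2 that by fastforce
  qed (use assms in auto)
  then show ?thesis by simp
qed

lemma riemann_zeta_eq_zeta_cont:
  assumes "s \<noteq> 1" "Re s > -1/2"
  shows "riemann_zeta s = zeta_cont s"
  unfolding riemann_zeta_def
proof (rule the_equality)
  show "\<exists>c f. c < Re s \<and> c \<le> 1 \<and> f holomorphic_on ({z. Re z > c} - {1}) \<and>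
     (\<forall>z. Re z > 1 \<longrightarrow> (\<lambda>n. of_nat (Suc n) powr (- z)) sums f z) \<and> zeta_cont s = f s"
    using holomorphic_zeta_cont sums_zeta_cont assms
    by (intro exI[of _ "-1/2"] exI[of _ zeta_cont]) auto
next
  fix v
  assume "\<exists>c f. c < Re s \<and> c \<le> 1 \<and> f holomorphic_on ({z. Re z > c} - {1}) \<and>
     (\<forall>z. Re z > 1 \<longrightarrow> (\<lambda>n. of_nat (Suc n) powr (- z)) sums f z) \<and> v = f s"
  then obtain c f where c: "c < Re s" "c \<le> 1"
    and f: "f holomorphic_on ({z. Re z > c} - {1})"
      "\<And>z. Re z > 1 \<Longrightarrow> (\<lambda>n. of_nat (Suc n) powr (- z)) sums f z" and v: "v = f s"
    by blast
  show "v = zeta_cont s"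
    unfolding v
    by (rule zeta_continuation_unique[OF c(2,1) assms(1) f _ assms(2)
          holomorphic_zeta_cont sums_zeta_cont]) auto
qed

text \<open>At \<open>s = 0\<close> the integrand is constant and the trapezoid rule exact, which
  leaves \<open>1 / (0 - 1) + 1 / 2\<close>.\<close>

lemma riemann_zeta_0: "riemann_zeta 0 = -1/2"
proof -
  have "trapezoid_error 0 = (\<lambda>n. 0)"
    by (auto simp: trapezoid_error_def fun_eq_iff simp del: of_nat_Suc)
       (simp add: of_nat_Suc)
  then show ?thesis
    by (simp add: riemann_zeta_eq_zeta_cont zeta_cont_def)
qed

lemma riemann_zeta_sums:
  assumes "n \<ge> 2"
  shows "(\<lambda>j. of_real (1 / real (Suc j) ^ n)) sums riemann_zeta (of_nat n)"
proof -
  have "(\<lambda>j. of_nat (Suc j) powr (- of_nat n)) sums riemann_zeta (of_nat n)"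
    using assms sums_zeta_cont[of "of_nat n"]
    by (subst riemann_zeta_eq_zeta_cont) auto
  then show ?thesis
    using assms by (simp add: powr_minus powr_nat' divide_inverse del: of_nat_Suc)
qed

section \<open>Complete homogeneous sums over partitions\<close>

definition bounded_partitions :: "nat \<Rightarrow> nat \<Rightarrow> nat list set" where
  "bounded_partitions N k = {l \<in> partitions_of_length k. set l \<subseteq> {..N}}"

text \<open>A decreasing list encodes a multiset of indices, so every monomial of degree
  \<open>k\<close> in \<open>x 1\<close>, ..., \<open>x N\<close> occurs exactly once.\<close>

definition complete_homogeneous :: "(nat \<Rightarrow> 'a::comm_semiring_1) \<Rightarrow> nat \<Rightarrow> nat \<Rightarrow> 'a" where
  "complete_homogeneous x N k = (\<Sum>l\<in>bounded_partitions N k. prod_list (map x l))"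

lemma finite_bounded_partitions: "finite (bounded_partitions N k)"
proof (rule finite_subset)
  show "bounded_partitions N k \<subseteq> {l. set l \<subseteq> {..N} \<and> length l = k}"
    by (auto simp: bounded_partitions_def partitions_of_length_def)
qed (rule finite_lists_length_eq, simp)

lemma complete_homogeneous_0_right [simp]: "complete_homogeneous x N 0 = 1"
proof -
  have "bounded_partitions N 0 = {[]}"
    by (auto simp: bounded_partitions_def partitions_of_length_def)
  then show ?thesis by (simp add: complete_homogeneous_def)
qed

lemma complete_homogeneous_0_left [simp]:
  "complete_homogeneous x 0 (Suc k) = 0"
proof -
  have "bounded_partitions 0 (Suc k) = {}"
    by (auto simp: bounded_partitions_def partitions_of_length_def length_Suc_conv)
  then show ?thesis by (simp add: complete_homogeneous_def)
qed

text \<open>The head of a decreasing list is its largest part: either it is \<open>Suc N\<close>,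
  and the tail may contain \<open>Suc N\<close> again, or all parts are at most
  \<open>N\<close>.\<close>

lemma bounded_partitions_Suc:
  "bounded_partitions (Suc N) (Suc k) =
     bounded_partitions N (Suc k) \<union> (#) (Suc N) ` bounded_partitions (Suc N) k"
proof (intro subset_antisym subsetI)
  fix l assume l: "l \<in> bounded_partitions (Suc N) (Suc k)"
  then obtain a r where ar: "l = a # r"
    by (auto simp: bounded_partitions_def partitions_of_length_def length_Suc_conv)
  show "l \<in> bounded_partitions N (Suc k) \<union> (#) (Suc N) ` bounded_partitions (Suc N) k"
    using l unfolding ar
    by (cases "a = Suc N")
       (fastforce simp: bounded_partitions_def partitions_of_length_def)+
qed (auto simp: bounded_partitions_def partitions_of_length_def)

lemma complete_homogeneous_Suc:
  "complete_homogeneous x (Suc N) (Suc k) =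
     complete_homogeneous x N (Suc k) + x (Suc N) * complete_homogeneous x (Suc N) k"
proof -
  have "bounded_partitions N (Suc k) \<inter> (#) (Suc N) ` bounded_partitions (Suc N) k = {}"
    by (auto simp: bounded_partitions_def)
  then show ?thesis
    by (simp add: complete_homogeneous_def bounded_partitions_Suc sum.union_disjoint
        finite_bounded_partitions sum.reindex sum_distrib_left)
qed

lemma complete_homogeneous_uminus:
  fixes x :: "nat \<Rightarrow> 'a::comm_ring_1"
  shows "complete_homogeneous (\<lambda>j. - x j) N k = (-1) ^ k * complete_homogeneous x N k"
proof -
  have "prod_list (map (\<lambda>j. - x j) l) = (-1) ^ length l * prod_list (map x l)" for l
    by (induction l) auto
  then show ?thesis
    by (auto simp: complete_homogeneous_def sum_distrib_left bounded_partitions_def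
        partitions_of_length_def intro!: sum.cong)
qed

section \<open>Generating functions and squared variables\<close>

text \<open>This is the product of 1 / (1 - x_j t) over j from 1 to \<open>N\<close>. Defining it by
  coefficients avoids division in the ring; multiplying by 1 - x_j t removes a factor.\<close>

definition homogeneous_fps :: "(nat \<Rightarrow> 'a::comm_ring_1) \<Rightarrow> nat \<Rightarrow> 'a fps" where
  "homogeneous_fps x N = Abs_fps (complete_homogeneous x N)"

lemma homogeneous_fps_0: "homogeneous_fps x 0 = 1"
proof (rule fps_ext)
  fix n show "fps_nth (homogeneous_fps x 0) n = fps_nth 1 n"
    by (cases n) (auto simp: homogeneous_fps_def)
qed

lemma homogeneous_fps_Suc:
  "(1 - fps_const (x (Suc N)) * fps_X) * homogeneous_fps x (Suc N) = homogeneous_fps x N"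
proof (rule fps_ext)
  fix n show "fps_nth ((1 - fps_const (x (Suc N)) * fps_X) * homogeneous_fps x (Suc N)) n
              = fps_nth (homogeneous_fps x N) n"
    by (cases n) (auto simp: homogeneous_fps_def left_diff_distrib mult.assoc complete_homogeneous_Suc)
qed

text \<open>This is \<open>homogeneous_fps\<close> with t^2 substituted for t.\<close>

definition even_homogeneous_fps :: "(nat \<Rightarrow> 'a::comm_ring_1) \<Rightarrow> nat \<Rightarrow> 'a fps" where
  "even_homogeneous_fps x N =
     Abs_fps (\<lambda>n. if even n then complete_homogeneous x N (n div 2) else 0)"

lemma even_homogeneous_fps_0: "even_homogeneous_fps x 0 = 1"
proof (rule fps_ext)
  fix n show "fps_nth (even_homogeneous_fps x 0) n = fps_nth 1 n"
    by (cases "n div 2") (auto simp: even_homogeneous_fps_def elim!: evenE)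
qed

lemma even_homogeneous_fps_Suc:
  "(1 - fps_const (x (Suc N)) * fps_X\<^sup>2) * even_homogeneous_fps x (Suc N)
     = even_homogeneous_fps x N"
proof (rule fps_ext)
  fix n
  consider "n = 0" | "n = 1" | m where "n = Suc (Suc m)"
    by (metis One_nat_def not0_implies_Suc)
  then show "fps_nth ((1 - fps_const (x (Suc N)) * fps_X\<^sup>2) * even_homogeneous_fps x (Suc N)) n
              = fps_nth (even_homogeneous_fps x N) n"
    by cases (auto simp: even_homogeneous_fps_def left_diff_distrib mult.assoc
        complete_homogeneous_Suc fps_X_power_mult_nth)
qed

text \<open>Induction removes one index at a time: 1 - x^2 t^2 = (1 - x t) (1 + x t) strips the last
  factor from both sides.\<close>

lemma homogeneous_fps_mult_uminus:
  fixes x :: "nat \<Rightarrow> 'a::idom"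
  shows "homogeneous_fps x N * homogeneous_fps (\<lambda>j. - x j) N
           = even_homogeneous_fps (\<lambda>j. (x j)\<^sup>2) N"
proof (induction N)
  case 0
  then show ?case by (simp add: homogeneous_fps_0 even_homogeneous_fps_0)
next
  case (Suc N)
  define c where "c = fps_const (x (Suc N))"
  let ?d = "1 - fps_const ((x (Suc N))\<^sup>2) * fps_X\<^sup>2"
  have d: "?d = (1 - c * fps_X) * (1 - fps_const (- x (Suc N)) * fps_X)"
    by (simp add: c_def algebra_simps power2_eq_square flip: fps_const_mult fps_const_neg)
  \<comment> \<open>The constant coefficient is 1, so this factor can be cancelled in the domain of
    power series.\<close>
  have "fps_nth ?d 0 \<noteq> 0" by simp
  then have nz: "?d \<noteq> 0" by (metis fps_zero_nth)
  have "?d * (homogeneous_fps x (Suc N) * homogeneous_fps (\<lambda>j. - x j) (Suc N)) =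
     ((1 - c * fps_X) * homogeneous_fps x (Suc N)) *
     ((1 - fps_const (- x (Suc N)) * fps_X) * homogeneous_fps (\<lambda>j. - x j) (Suc N))"
    unfolding d by (simp only: mult_ac)
  also have "\<dots> = homogeneous_fps x N * homogeneous_fps (\<lambda>j. - x j) N"
    unfolding c_def by (simp only: homogeneous_fps_Suc homogeneous_fps_Suc[of "\<lambda>j. - x j"])
  also have "\<dots> = ?d * even_homogeneous_fps (\<lambda>j. (x j)\<^sup>2) (Suc N)"
    by (simp only: Suc.IH even_homogeneous_fps_Suc[of "\<lambda>j. (x j)\<^sup>2"])
  finally show ?case using nz by simp
qed

lemma complete_homogeneous_square:
  fixes x :: "nat \<Rightarrow> 'a::idom"
  shows "complete_homogeneous (\<lambda>j. (x j)\<^sup>2) N k =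
     (\<Sum>n=0..2*k. (-1) ^ n * complete_homogeneous x N n * complete_homogeneous x N (2 * k - n))"
proof -
  have "complete_homogeneous (\<lambda>j. (x j)\<^sup>2) N k =
      fps_nth (even_homogeneous_fps (\<lambda>j. (x j)\<^sup>2) N) (2 * k)"
    by (simp add: even_homogeneous_fps_def)
  \<comment> \<open>The series in the negated variables comes first, so that the sign
    \<open>(-1) ^ n\<close> goes with the index \<open>n\<close>.\<close>
  also have "\<dots> = fps_nth (homogeneous_fps (\<lambda>j. - x j) N * homogeneous_fps x N) (2 * k)"
    by (simp add: homogeneous_fps_mult_uminus[symmetric] mult.commute)
  finally show ?thesis
    by (simp add: fps_mult_nth homogeneous_fps_def complete_homogeneous_uminus)
qed

section \<open>From bounded partitions to all partitions\<close>

text \<open>Nonnegative terms make the truncated sums increase to \<open>L\<close>, which bounds all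
  finite subsums and gives summability; the truncations eventually contain every finite set, so the
  total is \<open>L\<close>.\<close>

lemma has_sum_partitions_of_length:
  fixes x :: "nat \<Rightarrow> real"
  assumes nonneg: "\<And>j. x j \<ge> 0"
    and lim: "(\<lambda>N. complete_homogeneous x N k) \<longlonglongrightarrow> L"
  shows "((\<lambda>l. prod_list (map x l)) has_sum L) (partitions_of_length k)"
proof -
  let ?f = "\<lambda>l. prod_list (map x l)" and ?P = "partitions_of_length k"
  have pos: "?f l \<ge> 0" for l
    using nonneg by (induction l) auto
  have sub: "bounded_partitions N k \<subseteq> ?P" for N
    by (auto simp: bounded_partitions_def)
  have ex: "\<exists>N0. \<forall>N\<ge>N0. F \<subseteq> bounded_partitions N k" if F: "finite F" "F \<subseteq> ?P" for F
  proof (intro exI allI impI subsetI)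
    \<comment> \<open>\<open>N\<close> dominates every part of every partition in \<open>F\<close>;
      the inserted 0 keeps \<open>Max\<close> meaningful when there are no parts.\<close>
    fix N l assume N: "N \<ge> Max (insert 0 (\<Union> (set ` F)))" and l: "l \<in> F"
    have "finite (insert 0 (\<Union> (set ` F)))" using F by auto
    then have "a \<le> N" if "a \<in> set l" for a
      using N l that by (meson Max_ge UN_I insertI2 order_trans)
    then show "l \<in> bounded_partitions N k"
      using F l by (auto simp: bounded_partitions_def)
  qed
  have filt: "filterlim (\<lambda>N. bounded_partitions N k) (finite_subsets_at_top ?P) sequentially"
    unfolding filterlim_iff
  proof (intro allI impI)
    fix Q
    assume "eventually Q (finite_subsets_at_top ?P)"
    then obtain X where X: "finite X" "X \<subseteq> ?P"
      and Q: "\<forall>Y. finite Y \<and> X \<subseteq> Y \<and> Y \<subseteq> ?P \<longrightarrow> Q Y"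
      unfolding eventually_finite_subsets_at_top by (elim exE conjE)
    obtain N0 where "\<forall>N\<ge>N0. X \<subseteq> bounded_partitions N k" using ex[OF X] by blast
    then have "Q (bounded_partitions N k)" if "N \<ge> N0" for N
      using that finite_bounded_partitions sub by (intro Q[rule_format]) simp
    then show "eventually (\<lambda>N. Q (bounded_partitions N k)) sequentially"
      by (rule eventually_sequentiallyI)
  qed
  have mono: "incseq (\<lambda>N. complete_homogeneous x N k)"
    unfolding complete_homogeneous_def
    by (intro monoI sum_mono2 finite_bounded_partitions)
       (auto simp: bounded_partitions_def pos)
  have "?f summable_on ?P"
  proof (rule nonneg_bdd_above_summable_on)
    show "bdd_above (sum ?f ` {F. F \<subseteq> ?P \<and> finite F})"
    proof (intro bdd_aboveI2)
      fix F assume "F \<in> {F. F \<subseteq> ?P \<and> finite F}"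
      then obtain N where "F \<subseteq> bounded_partitions N k" using ex[of F] by auto
      then have "sum ?f F \<le> complete_homogeneous x N k"
        unfolding complete_homogeneous_def
        by (intro sum_mono2 finite_bounded_partitions pos)
      also have "\<dots> \<le> L" by (rule incseq_le[OF mono lim])
      finally show "sum ?f F \<le> L" .
    qed
  qed (rule pos)
  then obtain S where S: "(?f has_sum S) ?P" by (auto simp: summable_on_def)
  have "(\<lambda>N. complete_homogeneous x N k) \<longlonglongrightarrow> S"
    unfolding complete_homogeneous_def
    using filterlim_compose[OF S[unfolded has_sum_def] filt] .
  with lim have "S = L" by (rule LIMSEQ_unique[symmetric])
  with S show ?thesis by simp
qed

section \<open>Partial fractions for the inverse squares\<close>

text \<open>
  \<open>central_ratio N n\<close> equals \<open>(2 * N choose (N + n)) / (2 * N choose N)\<close>. Up to the factor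
  \<open>2 * (-1) ^ (n - 1)\<close> it is the coefficient \<open>\<Prod>m\<in>{1..N}-{n}. m\<^sup>2 / (m\<^sup>2 - n\<^sup>2)\<close> in the
  partial fraction decomposition of \<open>\<Prod>m\<in>{1..N}. 1 / (1 - x / m\<^sup>2)\<close>.
\<close>

definition central_ratio :: "nat \<Rightarrow> nat \<Rightarrow> real" where
  "central_ratio N n = (\<Prod>j<n. (real N - real j) / (real N + real j + 1))"

lemma central_ratio_0 [simp]: "central_ratio N 0 = 1"
  by (simp add: central_ratio_def)

lemma central_ratio_Suc:
  "central_ratio N (Suc n) = central_ratio N n * ((real N - real n) / (real N + real n + 1))"
  by (simp add: central_ratio_def)

lemma central_ratio_eq_0: "N < n \<Longrightarrow> central_ratio N n = 0"
  unfolding central_ratio_def by (rule prod_zero) auto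

lemma abs_central_ratio_le_1: "\<bar>central_ratio N n\<bar> \<le> 1"
  unfolding central_ratio_def abs_prod
  by (rule prod_le_1) (auto simp: abs_if divide_simps)

lemma tendsto_central_ratio: "(\<lambda>N. central_ratio N n) \<longlonglongrightarrow> 1"
proof -
  have "(\<lambda>N. (real N - real j) / (real N + real j + 1)) \<longlonglongrightarrow> 1" for j
    by real_asymp
  then have "(\<lambda>N. central_ratio N n) \<longlonglongrightarrow> (\<Prod>j<n. 1)"
    unfolding central_ratio_def by (intro tendsto_prod)
  then show ?thesis by simp
qed

text \<open>Adjoining the index \<open>N + 1\<close> divides the n-th partial fraction coefficient
  by this last factor. The multiplied form also covers \<open>n = N + 1\<close>, where the factor
  vanishes.\<close>

lemma central_ratio_Suc_left:
  "central_ratio N n = central_ratio (Suc N) n * (1 - (real n)\<^sup>2 / (real (Suc N))\<^sup>2)"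
proof (induction n)
  case (Suc n)
  \<comment> \<open>Factoring the differences of squares reduces both sides to (N + 1 - n) (N - n) /
    (N + 1)^2.\<close>
  have *: "((real N + 1 - real n) / (real N + 1 + real n + 1)) * (1 - (real n + 1)\<^sup>2 / (real N + 1)\<^sup>2)
      = (1 - (real n)\<^sup>2 / (real N + 1)\<^sup>2) * ((real N - real n) / (real N + real n + 1))"
  proof -
    have nz: "real N + 1 \<noteq> 0" "real N + 1 + real n + 1 \<noteq> 0" "real N + real n + 1 \<noteq> 0"
      by linarith+
    have sq: "1 - v\<^sup>2 / u\<^sup>2 = (u - v) * (u + v) / u\<^sup>2" if "u \<noteq> 0" for u v :: real
      using that by (simp add: field_simps power2_eq_square)
    have "1 - (real n + 1)\<^sup>2 / (real N + 1)\<^sup>2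
        = (real N - real n) * (real N + 1 + real n + 1) / (real N + 1)\<^sup>2"
      by (subst sq[OF nz(1)]) (simp add: add_ac)
    moreover have "1 - (real n)\<^sup>2 / (real N + 1)\<^sup>2
        = (real N + 1 - real n) * (real N + real n + 1) / (real N + 1)\<^sup>2"
      by (subst sq[OF nz(1)]) (simp add: add_ac)
    ultimately show ?thesis using nz by simp
  qed
  have "central_ratio N (Suc n) = central_ratio (Suc N) n *
      ((1 - (real n)\<^sup>2 / (real N + 1)\<^sup>2) * ((real N - real n) / (real N + real n + 1)))"
    by (simp add: central_ratio_Suc Suc.IH add_ac)
  also have "\<dots> = central_ratio (Suc N) (Suc n) * (1 - (real n + 1)\<^sup>2 / (real N + 1)\<^sup>2)"
    unfolding *[symmetric] by (simp add: central_ratio_Suc add_ac)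
  finally show ?case by (simp add: add_ac)
qed auto

text \<open>The sum telescopes. At \<open>m = N\<close> the remainder vanishes, which gives the
  value 1 of h_0.\<close>

lemma alternating_sum_central_ratio:
  assumes "N > 0"
  shows "(\<Sum>n<m. 2 * (-1) ^ n * central_ratio N (Suc n))
           = 1 - (-1) ^ m * central_ratio N m * (real N - real m) / real N"
proof (induction m)
  case (Suc m)
  \<comment> \<open>In terms of \<open>central_ratio N (Suc m)\<close>, consecutive remainders have
    numerators N + m + 1 and N - m - 1, which add up to 2 N.\<close>
  have *: "central_ratio N m * (real N - real m) = central_ratio N (Suc m) * (real N + real m + 1)"
    by (simp add: central_ratio_Suc)
  show ?case
    unfolding sum.lessThan_Suc Suc.IH
    unfolding mult.assoc *
    using assms by (simp add: field_simps)
qed (use assms in auto)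

text \<open>Geometric expansion of the partial fractions suggests the formula; the proof is a double
  induction along the recursion for h_k. For \<open>N = k = 0\<close> the empty sum is 0 but h_0 =
  1.\<close>

lemma complete_homogeneous_inverse_squares:
  assumes "N > 0 \<or> k > 0"
  shows "complete_homogeneous (\<lambda>j. 1 / real j ^ 2) N k =
           (\<Sum>n<N. 2 * (-1) ^ n * central_ratio N (Suc n) / real (Suc n) ^ (2 * k))"
  using assms
proof (induction k arbitrary: N)
  case 0
  then show ?case using alternating_sum_central_ratio[of N N] by simp
next
  case (Suc k)
  note IH_k = Suc.IH
  show ?case
  proof (induction N)
    case (Suc N)
    let ?t = "\<lambda>M i n. 2 * (-1) ^ n * central_ratio M (Suc n) / real (Suc n) ^ (2 * i)"
    \<comment> \<open>The extra summand contains \<open>central_ratio N (Suc N) = 0\<close>, so all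
      sums get the same range.\<close>
    have 1: "(\<Sum>n<N. ?t N (Suc k) n) = (\<Sum>n<Suc N. ?t N (Suc k) n)"
      by (simp add: central_ratio_eq_0)
    \<comment> \<open>By \<open>central_ratio_Suc_left\<close>, each term of the first sum misses
      its target by the fraction (n + 1)^2 / (N + 1)^2, which the second sum supplies.\<close>
    have 2: "(\<Sum>n<Suc N. ?t N (Suc k) n) + 1 / real (Suc N) ^ 2 * (\<Sum>n<Suc N. ?t (Suc N) k n)
        = (\<Sum>n<Suc N. ?t (Suc N) (Suc k) n)"
      unfolding sum_distrib_left sum.distrib[symmetric]
    proof (intro sum.cong refl)
      fix n
      have "real (Suc n) ^ (2 * Suc k) = real (Suc n) ^ (2 * k) * real (Suc n) ^ 2"
        by (simp flip: power_add)
      then show "2 * (-1) ^ n * central_ratio N (Suc n) / real (Suc n) ^ (2 * Suc k) +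
          1 / real (Suc N) ^ 2 * (2 * (-1) ^ n * central_ratio (Suc N) (Suc n) / real (Suc n) ^ (2 * k))
          = 2 * (-1) ^ n * central_ratio (Suc N) (Suc n) / real (Suc n) ^ (2 * Suc k)"
        unfolding central_ratio_Suc_left[of N "Suc n"]
        by (simp add: field_simps del: of_nat_Suc)
    qed
    show ?case
      unfolding complete_homogeneous_Suc Suc.IH IH_k[of "Suc N", OF disjI1, OF zero_less_Suc] 1
      by (rule 2)
  qed simp
qed

text \<open>Since \<open>central_ratio\<close> vanishes past \<open>N\<close>, the finite sums are
  series dominated by 2 / (n + 1)^(2k), and Tannery's theorem allows the termwise limit.\<close>

lemma tendsto_complete_homogeneous_inverse_squares:
  assumes "k > 0"
  shows "(\<lambda>N. complete_homogeneous (\<lambda>j. 1 / real j ^ 2) N k)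
           \<longlonglongrightarrow> (\<Sum>n. 2 * (-1) ^ n / real (Suc n) ^ (2 * k))"
proof -
  let ?a = "\<lambda>n N. 2 * (-1) ^ n * central_ratio N (Suc n) / real (Suc n) ^ (2 * k)"
  have "(\<lambda>N. \<Sum>n. ?a n N) \<longlonglongrightarrow> (\<Sum>n. 2 * (-1) ^ n / real (Suc n) ^ (2 * k))"
  proof (rule tannerys_theorem[THEN conjunct2, THEN conjunct2])
    show "(?a n) \<longlonglongrightarrow> 2 * (-1) ^ n / real (Suc n) ^ (2 * k)" for n
      by (rule tendsto_eq_intros tendsto_central_ratio refl | simp)+
    show "\<forall>\<^sub>F (n, N) in sequentially \<times>\<^sub>F sequentially.
        norm (?a n N) \<le> 2 * (1 / real (Suc n) ^ (2 * k))"
      using abs_central_ratio_le_1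
      by (intro always_eventually) (auto simp: abs_mult power_abs divide_right_mono)
    have "summable (\<lambda>n. 1 / real n ^ (2 * k))"
      using assms inverse_power_summable[of "2 * k", where 'a = real] by (simp add: divide_inverse)
    then have "summable (\<lambda>n. 1 / real (Suc n) ^ (2 * k))"
      by (subst summable_Suc_iff)
    then show "summable (\<lambda>n. 2 * (1 / real (Suc n) ^ (2 * k)))"
      by (rule summable_mult)
  qed simp
  also have "(\<lambda>N. \<Sum>n. ?a n N) = (\<lambda>N. complete_homogeneous (\<lambda>j. 1 / real j ^ 2) N k)"
  proof
    fix N
    have "(\<Sum>n. ?a n N) = (\<Sum>n<N. ?a n N)"
      by (intro suminf_finite) (auto simp: central_ratio_eq_0)
    then show "(\<Sum>n. ?a n N) = complete_homogeneous (\<lambda>j. 1 / real j ^ 2) N k"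
      using assms by (simp add: complete_homogeneous_inverse_squares)
  qed
  finally show ?thesis .
qed

text \<open>The signs arise by subtracting the terms at even integers twice; those terms add up to
  \<open>Z / 2 ^ s\<close>.\<close>

lemma alternating_sums:
  fixes Z :: real
  assumes "(\<lambda>j. 1 / real (Suc j) ^ s) sums Z"
  shows "(\<lambda>j. (-1) ^ j / real (Suc j) ^ s) sums ((1 - 2 / 2 ^ s) * Z)"
proof -
  let ?f = "\<lambda>j. 1 / real (Suc j) ^ s"
  \<comment> \<open>Indices start at 0, so the even integers sit at the odd indices
    \<open>2 * j + 1\<close>.\<close>
  have "(\<lambda>j. ?f (2 * j + 1)) sums (Z / 2 ^ s)"
  proof -
    have "(\<lambda>j. ?f j / 2 ^ s) sums (Z / 2 ^ s)" using assms by (rule sums_divide)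
    also have "(\<lambda>j. ?f j / 2 ^ s) = (\<lambda>j. ?f (2 * j + 1))"
    proof
      fix j
      have "real (Suc (2 * j + 1)) = real (Suc j) * 2" by simp
      then show "?f j / 2 ^ s = ?f (2 * j + 1)" by (simp only: power_mult_distrib) simp
    qed
    finally show ?thesis .
  qed
  then have "(\<lambda>j. (if odd (2 * j + 1) then ?f (2 * j + 1) else 0)) sums (Z / 2 ^ s)"
    by simp
  then have odd: "(\<lambda>j. if odd j then ?f j else 0) sums (Z / 2 ^ s)"
    by (subst (asm) sums_mono_reindex[of "\<lambda>j. 2 * j + 1" "\<lambda>j. if odd j then ?f j else 0"])
       (auto simp: strict_mono_def image_iff, presburger)
  have "(\<lambda>j. ?f j - 2 * (if odd j then ?f j else 0)) sums (Z - 2 * (Z / 2 ^ s))"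
    by (rule sums_diff[OF assms sums_mult[OF odd]])
  moreover have "(\<lambda>j. ?f j - 2 * (if odd j then ?f j else 0)) = (\<lambda>j. (-1) ^ j / real (Suc j) ^ s)"
    by (auto simp: fun_eq_iff)
  moreover have "Z - 2 * (Z / 2 ^ s) = (1 - 2 / 2 ^ s) * Z"
    by (simp add: left_diff_distrib)
  ultimately show ?thesis by (simp only:)
qed

section \<open>The dyadic recursion\<close>

text \<open>The prefactor is (1/2 - 1) / (1/4) = -2, so zeta(0) = -1/2 yields 1, in agreement with
  h_0.\<close>

lemma dyadic_formula_0_0: "dyadic_formula 0 0 = 1"
  by (simp add: riemann_zeta_0 power_int_minus)

lemma tendsto_dyadic_formula_0:
  "(\<lambda>N. complex_of_real (complete_homogeneous (\<lambda>j. 1 / real j ^ 2) N k)) \<longlonglongrightarrow> dyadic_formula 0 k"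
proof (cases "k = 0")
  case True
  then show ?thesis using dyadic_formula_0_0 by simp
next
  case False
  then have k: "k > 0" by simp
  have sm: "summable (\<lambda>j. complex_of_real (1 / real (Suc j) ^ (2 * k)))"
    and zeta: "(\<lambda>j. complex_of_real (1 / real (Suc j) ^ (2 * k))) sums riemann_zeta (of_nat (2 * k))"
    using riemann_zeta_sums[of "2 * k"] k by (auto simp: sums_iff)
  define Z where "Z = (\<Sum>j. 1 / real (Suc j) ^ (2 * k))"
  have Z: "(\<lambda>j. 1 / real (Suc j) ^ (2 * k)) sums Z"
    unfolding Z_def using sm by (intro summable_sums) (simp only: summable_complex_of_real)
  then have zeta_Z: "riemann_zeta (of_nat (2 * k)) = of_real Z"
    using sums_unique2[OF zeta] sums_of_real[where 'a = complex] by blast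
  have "(\<lambda>n. 2 * ((-1) ^ n / real (Suc n) ^ (2 * k))) sums (2 * ((1 - 2 / 2 ^ (2 * k)) * Z))"
    by (intro sums_mult alternating_sums Z)
  then have "(\<lambda>N. complete_homogeneous (\<lambda>j. 1 / real j ^ 2) N k)
      \<longlonglongrightarrow> 2 * ((1 - 2 / 2 ^ (2 * k)) * Z)"
    using tendsto_complete_homogeneous_inverse_squares[OF k] by (simp add: sums_iff)
  then have "(\<lambda>N. complex_of_real (complete_homogeneous (\<lambda>j. 1 / real j ^ 2) N k))
      \<longlonglongrightarrow> of_real (2 * ((1 - 2 / 2 ^ (2 * k)) * Z))"
    by (rule tendsto_of_real)
  \<comment> \<open>The prefactors agree: (2^(2k-1) - 1) / 2^(2k-2) = 2 (1 - 2 / 2^(2k)).\<close>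
  also have "of_real (2 * ((1 - 2 / 2 ^ (2 * k)) * Z)) = dyadic_formula 0 k"
  proof -
    have "(2::complex) powi (2 * int k) = 2 ^ (2 * k)"
      by (simp flip: power_int_of_nat)
    then show ?thesis
      unfolding dyadic_formula.simps zeta_Z by (simp add: power_int_diff field_simps)
  qed
  finally show ?thesis .
qed

text \<open>The induction treats all \<open>k\<close> at once, since the step at \<open>k\<close>
  uses the limits for every index up to \<open>2 * k\<close>.\<close>

lemma tendsto_dyadic_formula:
  "(\<lambda>N. complex_of_real (complete_homogeneous (\<lambda>j. 1 / real j ^ 2 ^ Suc m) N k))
     \<longlonglongrightarrow> dyadic_formula m k"
proof (induction m arbitrary: k)
  case 0
  then show ?case using tendsto_dyadic_formula_0 by simp
next
  case (Suc m)
  have "(\<lambda>j. 1 / real j ^ 2 ^ Suc (Suc m)) = (\<lambda>j. (1 / real j ^ 2 ^ Suc m)\<^sup>2)"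
    by (simp add: power_divide mult.commute flip: power_mult)
  then have "complex_of_real (complete_homogeneous (\<lambda>j. 1 / real j ^ 2 ^ Suc (Suc m)) N k) =
      (\<Sum>n=0..2*k. (-1) ^ n
         * complex_of_real (complete_homogeneous (\<lambda>j. 1 / real j ^ 2 ^ Suc m) N n)
         * complex_of_real (complete_homogeneous (\<lambda>j. 1 / real j ^ 2 ^ Suc m) N (2 * k - n)))" for N
    by (simp only: complete_homogeneous_square) simp
  then show ?case
    using Suc.IH by (simp only: dyadic_formula.simps) (intro tendsto_intros)
qed

lemma has_sum_dyadic_formula:
  "((\<lambda>l. 1 / of_nat (prod_list l) ^ 2 ^ Suc m) has_sum dyadic_formula m k) (partitions_of_length k)"
proof -
  let ?h = "\<lambda>N. complete_homogeneous (\<lambda>j. 1 / real j ^ 2 ^ Suc m) N k"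
  have "?h \<longlonglongrightarrow> Re (dyadic_formula m k)"
    using tendsto_Re[OF tendsto_dyadic_formula[of m k]] by simp
  then have "((\<lambda>l. prod_list (map (\<lambda>j. 1 / real j ^ 2 ^ Suc m) l)) has_sum Re (dyadic_formula m k))
      (partitions_of_length k)"
    by (intro has_sum_partitions_of_length) auto
  then have "((\<lambda>l. complex_of_real (prod_list (map (\<lambda>j. 1 / real j ^ 2 ^ Suc m) l)))
      has_sum of_real (Re (dyadic_formula m k))) (partitions_of_length k)"
    by (rule has_sum_of_real)
  moreover have "complex_of_real (prod_list (map (\<lambda>j. 1 / real j ^ 2 ^ Suc m) l))
      = 1 / of_nat (prod_list l) ^ 2 ^ Suc m" for l
    by (induction l) (auto simp: power_mult_distrib)
  \<comment> \<open>The monotone argument ran over the reals; a limit of real numbers equals its own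
    real part.\<close>
  moreover have "of_real (Re (dyadic_formula m k)) = dyadic_formula m k"
    using tendsto_of_real[where 'a = complex, OF \<open>?h \<longlonglongrightarrow> _\<close>] tendsto_dyadic_formula[of m k]
    by (rule LIMSEQ_unique)
  ultimately show ?thesis by (simp only:)
qed

lemma has_sum_powr_dyadic_formula:
  "((\<lambda>l. of_nat (prod_list l) powr (- (2 ^ Suc m :: complex))) has_sum dyadic_formula m k)
     (partitions_of_length k)"
proof -
  have "of_nat (prod_list l) powr (- (2 ^ Suc m :: complex)) = 1 / of_nat (prod_list l) ^ 2 ^ Suc m"
    if "l \<in> partitions_of_length k" for l
  proof -
    have "prod_list l \<noteq> 0"
      using that by (auto simp: partitions_of_length_def prod_list_zero_iff)
    then show ?thesis
      using powr_nat'[of "of_nat (prod_list l)" "2 ^ Suc m"]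
      by (simp add: powr_minus divide_inverse)
  qed
  then show ?thesis
    using has_sum_dyadic_formula[of m k] by (simp cong: has_sum_cong)
qed

text \<open>The two denominators multiply to \<open>2 powi (4 * int k - 4)\<close>, which is
  independent of \<open>n\<close> and factors out as \<open>16 ^ (k - 1)\<close>.\<close>

lemma dyadic_formula_1:
  assumes "k > 0"
  shows "dyadic_formula 1 k = 1 / 16 ^ (k - 1) *
             (\<Sum>n=0..2*k. (-1) ^ n
                * (2 powi (2 * int n - 1) - 1)
                * (2 powi (4 * int k - 2 * int n - 1) - 1)
                * riemann_zeta (of_nat (2 * n))
                * riemann_zeta (of_nat (4 * k - 2 * n)))"
proof -
  have pow16: "(2::complex) powi (4 * int k - 4) = 16 ^ (k - 1)"
  proof -
    have "4 * int k - 4 = int (4 * (k - 1))" using assms by simp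
    then have "(2::complex) powi (4 * int k - 4) = 2 ^ (4 * (k - 1))"
      by (simp only: power_int_of_nat)
    then show ?thesis by (simp add: power_mult)
  qed
  have "(-1) ^ n * dyadic_formula 0 n * dyadic_formula 0 (2 * k - n) =
      1 / 16 ^ (k - 1) * ((-1) ^ n
                * (2 powi (2 * int n - 1) - 1)
                * (2 powi (4 * int k - 2 * int n - 1) - 1)
                * riemann_zeta (of_nat (2 * n))
                * riemann_zeta (of_nat (4 * k - 2 * n)))" if "n \<in> {0..2*k}" for n
  proof -
    \<comment> \<open>The bound \<open>n \<le> 2 * k\<close> makes the subtraction of natural
      numbers exact.\<close>
    have 1: "2 * int (2 * k - n) = 4 * int k - 2 * int n" "2 * (2 * k - n) = 4 * k - 2 * n"
      using that by auto
    have "(2::complex) powi (2 * int n - 2) * 2 powi (4 * int k - 2 * int n - 2) = 16 ^ (k - 1)"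
      unfolding pow16[symmetric] by (simp flip: power_int_add)
    then show ?thesis
      unfolding dyadic_formula.simps 1 by (simp flip: times_divide_times_eq)
  qed
  then show ?thesis
    by (simp only: One_nat_def dyadic_formula.simps(2) sum_distrib_left cong: sum.cong)
qed

theorem corollary2p5:
  fixes k :: nat
  assumes "k > 0"
  shows "partition_zeta 4 k =
           (\<Sum>\<^sub>\<infinity>l\<in>partitions_of_length k. 1 / of_nat (prod_list l) ^ 4) \<and>
         ((\<lambda>l. 1 / of_nat (prod_list l) ^ 4) has_sum
           (1 / 16 ^ (k - 1) *
             (\<Sum>n=0..2*k. (-1) ^ n
                * (2 powi (2 * int n - 1) - 1)
                * (2 powi (4 * int k - 2 * int n - 1) - 1)
                * riemann_zeta (of_nat (2 * n))
                * riemann_zeta (of_nat (4 * k - 2 * n)))))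
           (partitions_of_length k) \<and>
         (\<forall>t::nat. t \<ge> 1 \<longrightarrow>
           (\<lambda>l. of_nat (prod_list l) powr (- (2 ^ t :: complex)))
              summable_on partitions_of_length k \<and>
           partition_zeta (2 ^ t) k = dyadic_formula (t - 1) k)"
proof (intro conjI allI impI)
  \<comment> \<open>Exponent 4 is \<open>2 ^ Suc 1\<close>, hence level 1 of the recursion.\<close>
  have 4: "((\<lambda>l. 1 / of_nat (prod_list l) ^ 4) has_sum dyadic_formula 1 k) (partitions_of_length k)"
    using has_sum_dyadic_formula[of 1 k] by (simp add: numeral_eq_Suc del: dyadic_formula.simps)
  then show "((\<lambda>l. 1 / of_nat (prod_list l) ^ 4) has_sum
           (1 / 16 ^ (k - 1) *
             (\<Sum>n=0..2*k. (-1) ^ n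
                * (2 powi (2 * int n - 1) - 1)
                * (2 powi (4 * int k - 2 * int n - 1) - 1)
                * riemann_zeta (of_nat (2 * n))
                * riemann_zeta (of_nat (4 * k - 2 * n)))))
           (partitions_of_length k)"
    by (simp only: dyadic_formula_1[OF assms])
  have powr: "partition_zeta (2 ^ Suc m) k = dyadic_formula m k" for m
    unfolding partition_zeta_def by (rule infsumI) (rule has_sum_powr_dyadic_formula)
  have "partition_zeta 4 k = dyadic_formula 1 k"
    using powr[of 1] by (simp del: dyadic_formula.simps)
  then show "partition_zeta 4 k = (\<Sum>\<^sub>\<infinity>l\<in>partitions_of_length k. 1 / of_nat (prod_list l) ^ 4)"
    using infsumI[OF 4] by simp
  fix t :: nat
  assume "t \<ge> 1"
  then obtain m where t: "t = Suc m" by (cases t) auto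
  show "(\<lambda>l. of_nat (prod_list l) powr (- (2 ^ t :: complex))) summable_on partitions_of_length k"
    unfolding t using has_sum_powr_dyadic_formula by (rule has_sum_imp_summable)
  show "partition_zeta (2 ^ t) k = dyadic_formula (t - 1) k"
    unfolding t by (simp only: powr diff_Suc_1)
qed

end
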